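(* Let $f\in\mathbb{R}[z_1,\dots,z_n]$ be a homogeneous polynomial of degree $d\geq 2$ with nonnegative coefficients. Suppose that (1) for all $\alpha\in\mathbb{Z}_{\geq 0}^n$ with $|\alpha|\leq d-2$, the polynomial $\partial^{\alpha} f$ is indecomposable, and (2) for all $\alpha\in\mathbb{Z}_{\geq 0}^n$ with $|\alpha|=d-2$, the quadratic polynomial $\partial^{\alpha}f$ is log-concave over $\mathbb{R}^n_{\geq 0}$. Then $f$ is completely log-concave.
   Context: For $\alpha\in\mathbb{Z}_{\geq 0}^n$, $|\alpha|=\sum_i\alpha_i$ and $\partial^\alpha=\prod_{i=1}^n\partial_{z_i}^{\alpha_i}$. For $v\in\mathbb{R}^n$, $D_v=\sum_{i=1}^n v_i\partial_{z_i}$. A polynomial $f$ is log-concave over $\mathbb{R}^n_{\geq 0}$ if $f(u)\geq 0$ for all $u\in\mathbb{R}^n_{\geq0}$ and $f(\lambda u+(1-\lambda)v)\geq f(u)^\lambda f(v)^{1-\lambda}$ for all $u,v\in\mathbb{R}^n_{\geq 0}$ and $\lambda\in[0,1]$ (the zero polynomial counts as log-concave). A polynomial $f$ is completely log-concave if for every finite collection of vectors $v_1,\dots,v_k\in\mathbb{R}^n_{\geq 0}$ (including $k=0$), the polynomial $D_{v_1}\cdots D_{v_k}f$ is nonnegative and log-concave over $\mathbb{R}^n_{\geq 0}$. A polynomial $f$ is indecomposable if it cannot be written as $f_1+f_2$ with $f_1,f_2$ nonzero polynomials in disjoint sets of variables; equivalently, the graph with vertex set $\{i:\partial_{z_i}f\neq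 0\}$ and edges $\{i,j\}$ whenever $\partial_{z_i}\partial_{z_j}f\neq 0$ is connected. *)

theory Defs
  imports "HOL-Analysis.Analysis" "HOL-Library.Poly_Mapping"
begin

section \<open>Real polynomials in finitely many variables\<close>

text \<open>
  The ring of real polynomials in the variables $z_i$, $i$ ranging over the finite type \<open>'n\<close>, is
  the monoid algebra over exponent vectors; \<open>Poly_Mapping.lookup f m\<close> is the coefficient of $z^m$.
\<close>

type_synonym 'n rpoly = "('n \<Rightarrow>\<^sub>0 nat) \<Rightarrow>\<^sub>0 real"

definition peval :: "'n::finite rpoly \<Rightarrow> real ^ 'n \<Rightarrow> real" where
  "peval f u = (\<Sum>m\<in>Poly_Mapping.keys f.
      Poly_Mapping.lookup f m * (\<Prod>i\<in>UNIV. (u $ i) ^ Poly_Mapping.lookup m i))"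

text \<open>The zero polynomial is homogeneous of every degree.\<close>

definition homogeneous :: "nat \<Rightarrow> 'n::finite rpoly \<Rightarrow> bool" where
  "homogeneous d f \<longleftrightarrow>
     (\<forall>m\<in>Poly_Mapping.keys f. (\<Sum>i\<in>UNIV. Poly_Mapping.lookup m i) = d)"

definition nonneg_coeffs :: "'n rpoly \<Rightarrow> bool" where
  "nonneg_coeffs f \<longleftrightarrow> (\<forall>m. 0 \<le> Poly_Mapping.lookup f m)"

definition pvars :: "'n rpoly \<Rightarrow> 'n set" where
  "pvars f = (\<Union>m\<in>Poly_Mapping.keys f. Poly_Mapping.keys m)"


section \<open>Derivatives\<close>

text \<open>
  The subtraction of exponents is truncated, but where it matters (exponent of $z_i$ zero) the
  coefficient vanishes.
\<close>

definition pdiff :: "'n \<Rightarrow> 'n rpoly \<Rightarrow> 'n rpoly" where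
  "pdiff i f = (\<Sum>m\<in>Poly_Mapping.keys f.
      Poly_Mapping.single (m - Poly_Mapping.single i 1)
        (Poly_Mapping.lookup f m * real (Poly_Mapping.lookup m i)))"

lemma lookup_pdiff:
  "Poly_Mapping.lookup (pdiff i f) m =
     real (Poly_Mapping.lookup m i + 1) * Poly_Mapping.lookup f (m + Poly_Mapping.single i 1)"
proof -
  let ?k = "m + Poly_Mapping.single i 1"
  have eq: "k = ?k" if "k - Poly_Mapping.single i 1 = m" "Poly_Mapping.lookup k i \<noteq> 0" for k
  proof (rule poly_mapping_eqI)
    fix j show "Poly_Mapping.lookup k j = Poly_Mapping.lookup ?k j"
      using that(2) by (auto simp flip: that(1)
          simp: Poly_Mapping.lookup_add Poly_Mapping.lookup_minus Poly_Mapping.lookup_single when_def)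
  qed
  have "Poly_Mapping.lookup (pdiff i f) m = (\<Sum>k\<in>Poly_Mapping.keys f.
      Poly_Mapping.lookup f k * real (Poly_Mapping.lookup k i) when k - Poly_Mapping.single i 1 = m)"
    by (simp add: pdiff_def Poly_Mapping.lookup_sum Poly_Mapping.lookup_single)
  also have "\<dots> = (\<Sum>k\<in>Poly_Mapping.keys f. if k = ?k then
      Poly_Mapping.lookup f k * real (Poly_Mapping.lookup k i) else 0)"
    by (rule sum.cong) (use eq in \<open>auto simp: when_def\<close>)
  also have "\<dots> = real (Poly_Mapping.lookup m i + 1) * Poly_Mapping.lookup f ?k"
    by (auto simp: sum.delta Poly_Mapping.lookup_add Poly_Mapping.in_keys_iff)
  finally show ?thesis .
qed

lemma pdiff_commute: "pdiff i (pdiff j f) = pdiff j (pdiff i f)"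
  by (rule poly_mapping_eqI)
    (auto simp: lookup_pdiff Poly_Mapping.lookup_add Poly_Mapping.lookup_single when_def add_ac)

text \<open>
  The composition of the operators \<open>pdiff i ^^ \<alpha> i\<close> over all variables; they commute, so the order is
  irrelevant.
\<close>

definition pdiffs :: "('n::finite \<Rightarrow> nat) \<Rightarrow> 'n rpoly \<Rightarrow> 'n rpoly" where
  "pdiffs \<alpha> f = Finite_Set.fold (\<lambda>i. pdiff i ^^ \<alpha> i) f UNIV"

lemma pdiff_funpow_commute: "(pdiff i ^^ a) (pdiff j f) = pdiff j ((pdiff i ^^ a) f)"
  by (induction a) (simp_all add: pdiff_commute[of i j])

lemma comp_fun_commute_pdiffs: "comp_fun_commute (\<lambda>i. pdiff i ^^ \<alpha> i)"
proof
  fix i j :: 'a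
  have "(pdiff i ^^ a) ((pdiff j ^^ b) f) = (pdiff j ^^ b) ((pdiff i ^^ a) f)" for a b f
    by (induction b) (simp_all add: pdiff_funpow_commute)
  then show "(pdiff j ^^ \<alpha> j) \<circ> (pdiff i ^^ \<alpha> i) = (pdiff i ^^ \<alpha> i) \<circ> (pdiff j ^^ \<alpha> j)"
    by auto
qed

definition dir_deriv :: "real ^ 'n \<Rightarrow> 'n::finite rpoly \<Rightarrow> 'n rpoly" where
  "dir_deriv v f = (\<Sum>i\<in>UNIV. Poly_Mapping.single 0 (v $ i) * pdiff i f)"


section \<open>Log-concavity\<close>

definition nonneg_orthant :: "(real ^ 'n) set" where
  "nonneg_orthant = {u. \<forall>i. 0 \<le> u $ i}"

text \<open>
  \<open>0 powr 0 = 0\<close> in Isabelle/HOL, but the inequality is trivial for \<open>t\<close> equal to 0 or 1 whichever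
  value is given to $0^0$.
\<close>

definition log_concave :: "'n::finite rpoly \<Rightarrow> bool" where
  "log_concave f \<longleftrightarrow>
     (\<forall>u\<in>nonneg_orthant. 0 \<le> peval f u) \<and>
     (\<forall>u\<in>nonneg_orthant. \<forall>v\<in>nonneg_orthant. \<forall>t\<in>{0..1}.
        peval f u powr t * peval f v powr (1 - t) \<le> peval f (t *\<^sub>R u + (1 - t) *\<^sub>R v))"

definition completely_log_concave :: "'n::finite rpoly \<Rightarrow> bool" where
  "completely_log_concave f \<longleftrightarrow>
     (\<forall>vs. set vs \<subseteq> nonneg_orthant \<longrightarrow> log_concave (foldr dir_deriv vs f))"


section \<open>Indecomposability\<close>

text \<open>
  A splitting $f = (f - c) + c$ with a constant $c$ must not count as a decomposition, since otherwise
  every polynomial, zero included, would be decomposable. Hence both summands are required to be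
  non-constant; this is what makes the notion agree with connectedness of the graph below.
\<close>

definition indecomposable :: "'n rpoly \<Rightarrow> bool" where
  "indecomposable f \<longleftrightarrow>
     \<not> (\<exists>f1 f2. f = f1 + f2 \<and> pvars f1 \<noteq> {} \<and> pvars f2 \<noteq> {} \<and> pvars f1 \<inter> pvars f2 = {})"

lemma pdiff_nonzero_iff: "pdiff i f \<noteq> 0 \<longleftrightarrow> i \<in> pvars f"
proof
  assume "pdiff i f \<noteq> 0"
  then obtain m where "Poly_Mapping.lookup (pdiff i f) m \<noteq> 0"
    by (metis poly_mapping_eqI lookup_zero)
  then have "m + Poly_Mapping.single i 1 \<in> Poly_Mapping.keys f"
    by (simp add: lookup_pdiff in_keys_iff)
  moreover have "i \<in> Poly_Mapping.keys (m + Poly_Mapping.single i (1::nat))"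
    by (simp add: in_keys_iff lookup_add)
  ultimately show "i \<in> pvars f" by (auto simp: pvars_def)
next
  assume "i \<in> pvars f"
  then obtain m where m: "m \<in> Poly_Mapping.keys f" "Poly_Mapping.lookup m i \<noteq> 0"
    by (auto simp: pvars_def in_keys_iff)
  have "m - Poly_Mapping.single i 1 + Poly_Mapping.single i 1 = m"
    by (rule poly_mapping_eqI) (use m in \<open>auto simp: lookup_add lookup_minus lookup_single when_def\<close>)
  then have "Poly_Mapping.lookup (pdiff i f) (m - Poly_Mapping.single i 1) \<noteq> 0"
    using m by (simp add: lookup_pdiff in_keys_iff)
  then show "pdiff i f \<noteq> 0" by auto
qed

lemma pvars_pdiff:
  assumes "i \<noteq> j"
  shows "j \<in> pvars (pdiff i f) \<longleftrightarrow> (\<exists>m\<in>Poly_Mapping.keys f. i \<in> Poly_Mapping.keys m \<and> j \<in> Poly_Mapping.keys m)"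
proof
  assume "j \<in> pvars (pdiff i f)"
  then obtain m where m: "m + Poly_Mapping.single i 1 \<in> Poly_Mapping.keys f" "j \<in> Poly_Mapping.keys m"
    by (auto simp: pvars_def in_keys_iff lookup_pdiff)
  then have "i \<in> Poly_Mapping.keys (m + Poly_Mapping.single i (1::nat))"
    "j \<in> Poly_Mapping.keys (m + Poly_Mapping.single i (1::nat))"
    by (auto simp: in_keys_iff lookup_add)
  with m show "\<exists>m\<in>Poly_Mapping.keys f. i \<in> Poly_Mapping.keys m \<and> j \<in> Poly_Mapping.keys m" by blast
next
  assume "\<exists>m\<in>Poly_Mapping.keys f. i \<in> Poly_Mapping.keys m \<and> j \<in> Poly_Mapping.keys m"
  then obtain m where m: "m \<in> Poly_Mapping.keys f" "Poly_Mapping.lookup m i \<noteq> 0" "Poly_Mapping.lookup m j \<noteq> 0"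
    by (auto simp: in_keys_iff)
  let ?m = "m - Poly_Mapping.single i 1"
  have "?m + Poly_Mapping.single i 1 = m"
    by (rule poly_mapping_eqI) (use m in \<open>auto simp: lookup_add lookup_minus lookup_single when_def\<close>)
  then have "?m \<in> Poly_Mapping.keys (pdiff i f)"
    using m by (simp add: lookup_pdiff in_keys_iff)
  moreover have "j \<in> Poly_Mapping.keys ?m"
    using m assms by (simp add: in_keys_iff lookup_minus lookup_single when_def)
  ultimately show "j \<in> pvars (pdiff i f)" by (auto simp: pvars_def)
qed

definition var_graph :: "'n rpoly \<Rightarrow> ('n \<times> 'n) set" where
  "var_graph f = {(i, j). i \<noteq> j \<and> pdiff i (pdiff j f) \<noteq> 0}"

text \<open>The empty graph (for constant \<open>f\<close>) counts as connected.\<close>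

lemma indecomposable_iff_connected:
  "indecomposable f \<longleftrightarrow>
     (\<forall>i j. pdiff i f \<noteq> 0 \<longrightarrow> pdiff j f \<noteq> 0 \<longrightarrow> (i, j) \<in> (var_graph f)\<^sup>*)"
proof
  assume ind: "indecomposable f"
  show "\<forall>i j. pdiff i f \<noteq> 0 \<longrightarrow> pdiff j f \<noteq> 0 \<longrightarrow> (i, j) \<in> (var_graph f)\<^sup>*"
  proof (rule ccontr)
    assume "\<not> ?thesis"
    then obtain i j where ij: "i \<in> pvars f" "j \<in> pvars f" "(i, j) \<notin> (var_graph f)\<^sup>*"
      by (auto simp: pdiff_nonzero_iff)
    define C where "C = {k. (i, k) \<in> (var_graph f)\<^sup>*}"
    define P where "P m \<longleftrightarrow> Poly_Mapping.keys m \<inter> C \<noteq> {}" for m :: "'a \<Rightarrow>\<^sub>0 nat"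
    define g where "g Q = (\<Sum>m\<in>{m\<in>Poly_Mapping.keys f. Q m}.
      Poly_Mapping.single m (Poly_Mapping.lookup f m))" for Q
    have lg: "Poly_Mapping.lookup (g Q) m = (if Q m then Poly_Mapping.lookup f m else 0)" for Q m
      by (auto simp: g_def lookup_sum lookup_single when_def sum.delta in_keys_iff)
    have kg: "Poly_Mapping.keys (g Q) = {m\<in>Poly_Mapping.keys f. Q m}" for Q
      by (auto simp: in_keys_iff lg split: if_splits)
    have inC: "Poly_Mapping.keys m \<subseteq> C" if "m \<in> Poly_Mapping.keys f" "P m" for m
    proof
      fix l assume l: "l \<in> Poly_Mapping.keys m"
      from that obtain k where k: "k \<in> Poly_Mapping.keys m" "k \<in> C" by (auto simp: P_def)
      show "l \<in> C"
      proof (cases "k = l")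
        case False
        then have "k \<in> pvars (pdiff l f)"
          using that k l by (auto simp: pvars_pdiff)
        then have "(k, l) \<in> var_graph f"
          using False by (simp add: var_graph_def pdiff_nonzero_iff)
        then show ?thesis using k by (auto simp: C_def)
      qed (use k in simp)
    qed
    have "f = g P + g (\<lambda>m. \<not> P m)"
      by (rule poly_mapping_eqI) (simp add: lookup_add lg)
    moreover have "pvars (g P) \<subseteq> C" "pvars (g (\<lambda>m. \<not> P m)) \<inter> C = {}"
      using inC by (auto simp: pvars_def kg P_def)
    moreover have "i \<in> pvars (g P)"
      using ij(1) by (auto simp: pvars_def kg P_def C_def)
    moreover have "j \<in> pvars (g (\<lambda>m. \<not> P m))"
    proof -
      obtain m where m: "m \<in> Poly_Mapping.keys f" "j \<in> Poly_Mapping.keys m"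
        using ij(2) by (auto simp: pvars_def)
      moreover have "\<not> P m" using inC m ij(3) by (auto simp: C_def)
      ultimately show ?thesis by (auto simp: pvars_def kg)
    qed
    ultimately show False using ind unfolding indecomposable_def by blast
  qed
next
  assume conn: "\<forall>i j. pdiff i f \<noteq> 0 \<longrightarrow> pdiff j f \<noteq> 0 \<longrightarrow> (i, j) \<in> (var_graph f)\<^sup>*"
  show "indecomposable f"
    unfolding indecomposable_def
  proof
    assume "\<exists>f1 f2. f = f1 + f2 \<and> pvars f1 \<noteq> {} \<and> pvars f2 \<noteq> {} \<and> pvars f1 \<inter> pvars f2 = {}"
    then obtain f1 f2 i j where f: "f = f1 + f2" and disj: "pvars f1 \<inter> pvars f2 = {}"
      and i: "i \<in> pvars f1" and j: "j \<in> pvars f2" by blast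
    have keys_f: "m \<in> Poly_Mapping.keys f \<longleftrightarrow> m \<in> Poly_Mapping.keys f1 \<or> m \<in> Poly_Mapping.keys f2"
      if "k \<in> Poly_Mapping.keys m" for m k
    proof -
      have "Poly_Mapping.lookup f1 m = 0 \<or> Poly_Mapping.lookup f2 m = 0"
        using that disj unfolding pvars_def not_in_keys_iff_lookup_eq_zero[symmetric] by blast
      then show ?thesis by (auto simp: f in_keys_iff lookup_add)
    qed
    have "i \<in> pvars f" "j \<in> pvars f"
      using i j keys_f by (auto simp: pvars_def)
    then have "(i, j) \<in> (var_graph f)\<^sup>*"
      using conn by (simp add: pdiff_nonzero_iff)
    then have "j \<in> pvars f1"
    proof (induction rule: rtrancl_induct)
      case base then show ?case by (fact i)
    next
      case (step k l)
      then have "k \<noteq> l" "k \<in> pvars (pdiff l f)"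
        by (auto simp: var_graph_def pdiff_nonzero_iff)
      then obtain m where m: "m \<in> Poly_Mapping.keys f" "k \<in> Poly_Mapping.keys m" "l \<in> Poly_Mapping.keys m"
        by (auto simp: pvars_pdiff)
      then show ?case using step.IH disj keys_f by (fastforce simp: pvars_def)
    qed
    with j disj show False by blast
  qed
qed

end

theory Submission
  imports Defs
begin

text \<open>
  All data are read off the constants $D_{v_1} \cdots D_{v_d} f$, which are symmetric and multilinear
  in the vectors. Call a symmetric bilinear form Lorentzian here if it is negative semidefinite on a
  hyperplane; equivalently it satisfies the reverse Cauchy--Schwarz inequality against every vector
  on which it is positive. If two such forms $B$, $C$ satisfy $B(b, \cdot) = C(c, \cdot) \neq 0$ with
  $B(b,b), C(c,c) \geq 0$, both are negative semidefinite on the kernel of this functional, and hence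
  so is $B + C$.

  By induction on the degree the form $D_{v_1} \cdots D_{v_{d-2}} f$ is Lorentzian for strictly
  positive $v_i$. Expand $D_{v_1} = \sum_i v_{1,i} \partial_i$; the forms $B_i$ obtained from
  $\partial_i f$ are Lorentzian by induction, and $B_i(e_j, \cdot) = B_j(e_i, \cdot)$. So the sum
  $\sum_{i \in T} v_{1,i} B_i$ may be enlarged by any $j$ adjacent to $T$ in the variable graph, which
  is connected.

  Reverse Cauchy--Schwarz makes the sequence $a_j = D_u^j D_v^{e-j} g$ log-concave for every
  $g = D_{v_1} \cdots D_{v_k} f$ of degree $e$, so that $a_j \geq A^j B^{e-j}$ with $A^e = a_e = e!\,g(u)$
  and $B^e = a_0 = e!\,g(v)$. Hence $e!\,g(tu + (1-t)v) \geq (tA + (1-t)B)^e \geq (A^t B^{1-t})^e$.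
  Vectors on the boundary of the orthant are reached by a limit.
\<close>

section \<open>Forms that are negative semidefinite on a hyperplane\<close>

text \<open>\<open>l = 0\<close> is allowed, so forms that are negative semidefinite everywhere,
  such as the zero form, qualify. For a symmetric bilinear form in finite dimension the condition
  means at most one positive eigenvalue.\<close>

definition nsd_on_hyperplane :: "('a::real_vector \<Rightarrow> 'a \<Rightarrow> real) \<Rightarrow> bool" where
  "nsd_on_hyperplane B \<longleftrightarrow> (\<exists>l. linear l \<and> (\<forall>x. l x = (0::real) \<longrightarrow> B x x \<le> 0))"

text \<open>The vector \<open>?w\<close> combines \<open>x\<close> and \<open>z\<close> so as to lie
  in the kernel of \<open>l\<close>, hence \<open>B ?w ?w \<le> 0\<close>. Multiplying by
  \<open>B z z\<close> and completing the square isolates the discriminant with factor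
  \<open>b\<^sup>2\<close>; were it positive, \<open>z\<close> itself would lie in the
  kernel.\<close>

lemma reverse_cauchy_schwarz:
  assumes bil: "bilinear B" and sym: "\<And>x y. B x y = B y x"
    and nsd: "nsd_on_hyperplane B" and pos: "0 < B z z"
  shows "B x x * B z z \<le> (B x z)\<^sup>2"
proof (rule ccontr)
  obtain l where l: "linear l" "\<And>x. l x = (0::real) \<Longrightarrow> B x x \<le> 0"
    using nsd unfolding nsd_on_hyperplane_def by blast
  define a b where "a = l x" and "b = l z"
  let ?w = "b *\<^sub>R x - a *\<^sub>R z"
  assume "\<not> ?thesis"
  then have gt: "0 < B x x * B z z - (B x z)\<^sup>2" by simp
  have "l ?w = 0"
    using l(1) by (simp add: linear_diff linear_scale a_def b_def)
  then have "B z z * B ?w ?w \<le> 0"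
    using l(2) pos by (simp add: mult_le_0_iff)
  also have "B ?w ?w = b\<^sup>2 * B x x - 2 * a * b * B x z + a\<^sup>2 * B z z"
    by (simp add: bilinear_lsub[OF bil] bilinear_rsub[OF bil] bilinear_lmul[OF bil]
        bilinear_rmul[OF bil] sym[of z x] power2_eq_square algebra_simps)
  also have "B z z * \<dots> = (a * B z z - b * B x z)\<^sup>2 + b\<^sup>2 * (B x x * B z z - (B x z)\<^sup>2)"
    by (simp add: power2_eq_square algebra_simps)
  finally have *: "(a * B z z - b * B x z)\<^sup>2 + b\<^sup>2 * (B x x * B z z - (B x z)\<^sup>2) \<le> 0" .
  have "b\<^sup>2 * (B x x * B z z - (B x z)\<^sup>2) \<le> 0"
    using * zero_le_power2[of "a * B z z - b * B x z"] by linarith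
  then have "b = 0" using gt by (simp add: mult_le_0_iff)
  then show False using l(2)[of z] pos by (simp add: b_def)
qed

text \<open>For \<open>B b b > 0\<close> this is reverse Cauchy-Schwarz against \<open>b\<close>. To
  include \<open>B b b = 0\<close>, assume \<open>B x x > 0\<close> and apply the inequality against
  \<open>x\<close> to a perturbation of \<open>b\<close> along \<open>z\<close>: the gain is linear
  in \<open>r\<close>, the loss quadratic.\<close>

lemma nonpos_on_orthogonal:
  assumes bil: "bilinear B" and sym: "\<And>x y. B x y = B y x"
    and nsd: "nsd_on_hyperplane B"
    and b: "0 \<le> B b b" "B b z \<noteq> 0" and x: "B b x = 0"
  shows "B x x \<le> 0"
proof (rule ccontr)
  assume "\<not> ?thesis"
  then have pos: "0 < B x x" by simp
  let ?\<beta> = "B b z"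
  define K where "K = (B z x)\<^sup>2 - B z z * B x x"
  have key: "2 * B x x \<le> r * K" if "0 < r" for r
  proof -
    let ?y = "b + (r * ?\<beta>) *\<^sub>R z"
    have "B ?y ?y = B b b + 2 * (r * ?\<beta>) * ?\<beta> + (r * ?\<beta>)\<^sup>2 * B z z"
      by (simp add: bilinear_ladd[OF bil] bilinear_radd[OF bil] bilinear_lmul[OF bil]
          bilinear_rmul[OF bil] sym[of z b] power2_eq_square algebra_simps)
    moreover have "B ?y x = (r * ?\<beta>) * B z x"
      by (simp add: bilinear_ladd[OF bil] bilinear_lmul[OF bil] x)
    ultimately have "(B b b + 2 * (r * ?\<beta>) * ?\<beta> + (r * ?\<beta>)\<^sup>2 * B z z) * B x x \<le> ((r * ?\<beta>) * B z x)\<^sup>2"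
      using reverse_cauchy_schwarz[OF bil sym nsd pos, of ?y] by simp
    moreover have "0 \<le> B b b * B x x" using b pos by simp
    ultimately have "(r * ?\<beta>\<^sup>2) * (2 * B x x) \<le> (r * ?\<beta>\<^sup>2) * (r * K)"
      by (simp add: K_def power2_eq_square algebra_simps)
    then show ?thesis using that b by (subst (asm) mult_le_cancel_left_pos) auto
  qed
  \<comment> \<open>This \<open>r\<close> is small enough for \<open>r * K \<le> B x x\<close>,
    which contradicts the factor 2 in \<open>key\<close>.\<close>
  have "2 * B x x \<le> B x x / (\<bar>K\<bar> + 1) * K"
    using pos by (intro key) simp
  also have "\<dots> = B x x * (K / (\<bar>K\<bar> + 1))" by simp
  also have "\<dots> \<le> B x x * 1"
    using pos by (intro mult_left_mono) auto
  finally show False using pos by simp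
qed

text \<open>In general the two hyperplanes differ and the sum can have two positive directions. The
  shared functional \<open>B b\<close> provides one hyperplane that serves both forms.\<close>

lemma nsd_on_hyperplane_add:
  assumes "bilinear B" "\<And>x y. B x y = B y x" "nsd_on_hyperplane B"
    and "bilinear C" "\<And>x y. C x y = C y x" "nsd_on_hyperplane C"
    and "0 \<le> B b b" "0 \<le> C c c" "\<And>x. B b x = C c x" "B b z \<noteq> 0"
  shows "nsd_on_hyperplane (\<lambda>x y. B x y + C x y)"
  unfolding nsd_on_hyperplane_def
proof (intro exI[of _ "B b"] conjI allI impI)
  show "linear (B b)" using assms(1) by (simp add: bilinear_def)
  fix x assume x: "B b x = 0"
  have "B x x \<le> 0" by (rule nonpos_on_orthogonal[OF assms(1-3,7,10) x])
  moreover have "C x x \<le> 0"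
    by (rule nonpos_on_orthogonal[OF assms(4-6,8)]) (use assms(9,10) x in auto)
  ultimately show "B x x + C x x \<le> 0" by simp
qed

lemma nsd_on_hyperplane_scale:
  assumes "nsd_on_hyperplane B" "0 \<le> c"
  shows "nsd_on_hyperplane (\<lambda>x y. c * B x y)"
  using assms unfolding nsd_on_hyperplane_def by (meson mult_nonneg_nonpos)


section \<open>Log-concave sequences\<close>

text \<open>Induction on the right endpoint: \<open>b e\<close> is bounded from below by the chord
  to \<open>Suc e\<close>, which turns the chord up to \<open>e\<close> into the longer one.
  Denominators are cleared.\<close>

lemma concave_seq_above_chord:
  fixes b :: "nat \<Rightarrow> real"
  assumes "\<And>k. 0 < k \<Longrightarrow> k < e \<Longrightarrow> b (k - 1) + b (k + 1) \<le> 2 * b k" and "j \<le> e"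
  shows "real j * b e + (real e - real j) * b 0 \<le> real e * b j"
  using assms
proof (induction e arbitrary: j)
  case (Suc e)
  have IH: "real i * b e + (real e - real i) * b 0 \<le> real e * b i" if "i \<le> e" for i
    by (rule Suc.IH) (use that Suc.prems(1) in auto)
  \<comment> \<open>The point \<open>b e\<close> against the chord from 0 to \<open>Suc e\<close>:
    the induction hypothesis at \<open>e - 1\<close> is added to \<open>e\<close> times concavity at
    \<open>e\<close>.\<close>
  have last: "real e * b (Suc e) + b 0 \<le> (real e + 1) * b e"
  proof (cases e)
    case (Suc k)
    have "real k * b (Suc k) + b 0 \<le> (real k + 1) * b k" using IH[of k] Suc by (simp add: algebra_simps)
    moreover have "b k + b (Suc (Suc k)) \<le> 2 * b (Suc k)"
      using Suc.prems(1)[of "Suc k"] Suc by simp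
    then have "(real k + 1) * (b k + b (Suc (Suc k))) \<le> (real k + 1) * (2 * b (Suc k))"
      by (intro mult_left_mono) auto
    ultimately show ?thesis using Suc by (simp add: algebra_simps)
  qed simp
  show ?case
  proof (cases "j = Suc e")
    case False
    then have j: "j \<le> e" using Suc.prems by simp
    show ?thesis
    proof (cases "e = 0")
      case False
      have "(real e + 1) * (real j * b e + (real e - real j) * b 0) \<le> (real e + 1) * (real e * b j)"
        using IH[OF j] by (intro mult_left_mono) auto
      moreover have "real j * (real e * b (Suc e) + b 0) \<le> real j * ((real e + 1) * b e)"
        using last by (intro mult_left_mono) auto
      \<comment> \<open>In the sum of the two inequalities the terms with \<open>b e\<close> cancel
        and a common factor \<open>e\<close> remains; hence the separate case
        \<open>e = 0\<close>.\<close>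
      ultimately have "real e * (real j * b (Suc e) + (real (Suc e) - real j) * b 0) \<le>
          real e * (real (Suc e) * b j)"
        by (simp add: algebra_simps)
      then show ?thesis using False by simp
    qed (use j in simp)
  qed simp
qed simp

text \<open>The chord bound for \<open>ln (a k)\<close>, exponentiated. \<open>A\<close> and
  \<open>B\<close> are the \<open>e\<close>-th roots of the end values, written with
  \<open>exp\<close> and \<open>ln\<close> so that powers become multiples of logarithms.\<close>

lemma log_concave_seq_lower_bound:
  fixes a :: "nat \<Rightarrow> real"
  assumes e: "0 < e" and pos: "\<And>k. k \<le> e \<Longrightarrow> 0 < a k"
    and lc: "\<And>k. 0 < k \<Longrightarrow> k < e \<Longrightarrow> a (k - 1) * a (k + 1) \<le> (a k)\<^sup>2"
  obtains A B where "0 < A" "0 < B" "a e = A ^ e" "a 0 = B ^ e"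
    "\<And>j. j \<le> e \<Longrightarrow> A ^ j * B ^ (e - j) \<le> a j"
proof -
  define A B where "A = exp (ln (a e) / e)" and "B = exp (ln (a 0) / e)"
  have "A ^ j * B ^ (e - j) \<le> a j" if "j \<le> e" for j
  proof -
    have "j * ln (a e) + (real e - real j) * ln (a 0) \<le> e * ln (a j)"
    proof (rule concave_seq_above_chord[OF _ that])
      fix k assume k: "0 < k" "k < e"
      have pos': "0 < a (k - 1)" "0 < a (k + 1)" "0 < a k"
        using pos k by auto
      have "ln (a (k - 1) * a (k + 1)) \<le> ln ((a k)\<^sup>2)"
        using lc[OF k] pos' by (subst ln_le_cancel_iff) auto
      then show "ln (a (k - 1)) + ln (a (k + 1)) \<le> 2 * ln (a k)"
        using pos' by (simp add: ln_mult ln_realpow)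
    qed
    then have "j * (ln (a e) / e) + (real e - real j) * (ln (a 0) / e) \<le> ln (a j)"
      using e by (simp add: field_simps)
    then have "exp (j * (ln (a e) / e) + real (e - j) * (ln (a 0) / e)) \<le> a j"
      using pos[OF that] that by (simp add: of_nat_diff flip: ln_ge_iff)
    then show ?thesis
      unfolding A_def B_def exp_add exp_of_nat_mult .
  qed
  moreover have "a e = A ^ e" "a 0 = B ^ e"
    using e pos[of e] pos[of 0] by (simp_all add: A_def B_def flip: exp_of_nat_mult)
  moreover have "0 < A" "0 < B" by (simp_all add: A_def B_def)
  ultimately show ?thesis using that by blast
qed


section \<open>Directional derivatives\<close>

lemma lookup_const_times [simp]:
  "Poly_Mapping.lookup (Poly_Mapping.single 0 c * p) m = c * Poly_Mapping.lookup p m"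
  for p :: "'n rpoly"
  by (simp flip: mult_map_scale_conv_mult add: Poly_Mapping.map.rep_eq when_def)

lemma lookup_dir_deriv:
  "Poly_Mapping.lookup (dir_deriv v f) m =
     (\<Sum>i\<in>UNIV. v $ i * (real (Poly_Mapping.lookup m i + 1) *
        Poly_Mapping.lookup f (m + Poly_Mapping.single i 1)))"
  by (simp add: dir_deriv_def lookup_sum lookup_pdiff)

lemma dir_deriv_add_left: "dir_deriv (u + v) f = dir_deriv u f + dir_deriv v f"
  by (rule poly_mapping_eqI) (simp add: lookup_dir_deriv lookup_add algebra_simps sum.distrib)

lemma dir_deriv_add: "dir_deriv v (f + g) = dir_deriv v f + dir_deriv v g"
  by (rule poly_mapping_eqI) (simp add: lookup_dir_deriv lookup_add algebra_simps sum.distrib)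

lemma dir_deriv_scaleR: "dir_deriv (c *\<^sub>R v) f = Poly_Mapping.single 0 c * dir_deriv v f"
  by (rule poly_mapping_eqI) (simp add: lookup_dir_deriv sum_distrib_left mult.assoc)

lemma dir_deriv_const_times:
  "dir_deriv v (Poly_Mapping.single 0 c * f) = Poly_Mapping.single 0 c * dir_deriv v f"
  by (rule poly_mapping_eqI) (simp add: lookup_dir_deriv sum_distrib_left mult.left_commute[of c])

lemma dir_deriv_axis: "dir_deriv (axis i 1) f = pdiff i f"
  by (rule poly_mapping_eqI)
    (simp add: lookup_dir_deriv lookup_pdiff axis_def if_distrib [of "\<lambda>x. x * _"] cong: if_cong)

lemma dir_deriv_zero [simp]: "dir_deriv v 0 = 0"
  by (rule poly_mapping_eqI) (simp add: lookup_dir_deriv)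

lemma dir_deriv_zero_left [simp]: "dir_deriv 0 f = 0"
  by (rule poly_mapping_eqI) (simp add: lookup_dir_deriv)

lemma pdiff_zero [simp]: "pdiff i 0 = 0"
  by (simp add: pdiff_def)

lemma pdiff_const_times: "pdiff i (Poly_Mapping.single 0 c * f) = Poly_Mapping.single 0 c * pdiff i f"
  by (rule poly_mapping_eqI) (simp add: lookup_pdiff)

lemma pdiff_sum: "pdiff i (sum g A) = (\<Sum>x\<in>A. pdiff i (g x))"
  by (rule poly_mapping_eqI) (simp add: lookup_pdiff lookup_sum sum_distrib_left)

lemma dir_deriv_sum: "dir_deriv v (sum g A) = (\<Sum>x\<in>A. dir_deriv v (g x))"
  by (induction A rule: infinite_finite_induct) (simp_all add: dir_deriv_add)

lemma dir_deriv_pdiff: "dir_deriv v (pdiff i f) = pdiff i (dir_deriv v f)"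
  by (simp add: dir_deriv_def pdiff_sum pdiff_const_times pdiff_commute[of i])

lemma dir_deriv_commute: "dir_deriv u (dir_deriv v f) = dir_deriv v (dir_deriv u f)"
proof -
  have "dir_deriv u (dir_deriv v f) =
      (\<Sum>i\<in>UNIV. Poly_Mapping.single 0 (v $ i) * pdiff i (dir_deriv u f))"
    by (subst (2) dir_deriv_def) (simp add: dir_deriv_sum dir_deriv_const_times dir_deriv_pdiff)
  also have "\<dots> = dir_deriv v (dir_deriv u f)"
    by (rule dir_deriv_def [symmetric])
  finally show ?thesis .
qed

lemma foldr_dir_deriv_commute:
  "foldr dir_deriv vs (dir_deriv v f) = dir_deriv v (foldr dir_deriv vs f)"
  by (induction vs) (simp_all add: dir_deriv_commute)

lemma foldr_dir_deriv_add:
  "foldr dir_deriv vs (f + g) = foldr dir_deriv vs f + foldr dir_deriv vs g"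
  by (induction vs) (simp_all add: dir_deriv_add)

lemma foldr_dir_deriv_const_times:
  "foldr dir_deriv vs (Poly_Mapping.single 0 c * f) = Poly_Mapping.single 0 c * foldr dir_deriv vs f"
  by (induction vs) (simp_all add: dir_deriv_const_times)

lemma foldr_dir_deriv_zero [simp]: "foldr dir_deriv vs 0 = 0"
  by (induction vs) simp_all

section \<open>Homogeneous polynomials and their degrees\<close>

lemma nonzero_lookupE:
  assumes "f \<noteq> 0"
  obtains m where "Poly_Mapping.lookup f m \<noteq> 0"
proof -
  have "\<exists>m. Poly_Mapping.lookup f m \<noteq> 0"
    using assms by (rule contrapos_np) (auto intro: poly_mapping_eqI)
  then show ?thesis using that by blast
qed

lemma homogeneous_lookup:
  "homogeneous d f \<longleftrightarrow>
     (\<forall>m. Poly_Mapping.lookup f m \<noteq> 0 \<longrightarrow> (\<Sum>i\<in>UNIV. Poly_Mapping.lookup m i) = d)"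
  by (auto simp: homogeneous_def in_keys_iff)

lemma homogeneous_pdiff:
  assumes "homogeneous (Suc d) f"
  shows "homogeneous d (pdiff i f)"
  unfolding homogeneous_lookup
proof (intro allI impI)
  fix m assume "Poly_Mapping.lookup (pdiff i f) m \<noteq> 0"
  then have "(\<Sum>j\<in>UNIV. Poly_Mapping.lookup (m + Poly_Mapping.single i 1) j) = Suc d"
    using assms unfolding homogeneous_lookup lookup_pdiff by auto
  then show "(\<Sum>j\<in>UNIV. Poly_Mapping.lookup m j) = d"
    by (simp add: lookup_add sum.distrib lookup_single when_def)
qed

lemma homogeneous_dir_deriv:
  assumes "homogeneous (Suc d) f"
  shows "homogeneous d (dir_deriv v f)"
  unfolding homogeneous_lookup
proof (intro allI impI)
  fix m assume "Poly_Mapping.lookup (dir_deriv v f) m \<noteq> 0"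
  then have "\<exists>i. Poly_Mapping.lookup (pdiff i f) m \<noteq> 0"
    by (rule contrapos_np) (simp add: dir_deriv_def lookup_sum)
  then obtain i where "Poly_Mapping.lookup (pdiff i f) m \<noteq> 0" ..
  then show "(\<Sum>j\<in>UNIV. Poly_Mapping.lookup m j) = d"
    using homogeneous_pdiff[OF assms] by (auto simp: homogeneous_lookup)
qed

lemma homogeneous_0_dir_deriv:
  assumes "homogeneous 0 f"
  shows "dir_deriv v f = 0"
proof (rule poly_mapping_eqI)
  fix m
  have "Poly_Mapping.lookup f (m + Poly_Mapping.single i 1) = 0" for i
  proof (rule ccontr)
    assume "\<not> ?thesis"
    then have "(\<Sum>j\<in>UNIV. Poly_Mapping.lookup (m + Poly_Mapping.single i 1) j) = 0"
      using assms by (auto simp: homogeneous_lookup)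
    then have "Poly_Mapping.lookup (m + Poly_Mapping.single i 1) i = 0" by simp
    then show False by (simp add: lookup_add)
  qed
  then show "Poly_Mapping.lookup (dir_deriv v f) m = Poly_Mapping.lookup 0 m"
    by (simp add: lookup_dir_deriv)
qed

lemma homogeneous_foldr:
  assumes "homogeneous (length vs + d) f"
  shows "homogeneous d (foldr dir_deriv vs f)"
  using assms
proof (induction vs arbitrary: d)
  case (Cons v vs)
  then show ?case by (auto intro!: homogeneous_dir_deriv)
qed simp

lemma foldr_dir_deriv_eq_0:
  assumes "homogeneous d f" "d < length vs"
  shows "foldr dir_deriv vs f = 0"
  using assms
proof (induction vs)
  case (Cons v vs)
  show ?case
  proof (cases "d < length vs")
    case True
    then show ?thesis using Cons by simp
  next
    case False
    then have "homogeneous (length vs + 0) f" using Cons.prems by (simp add: less_Suc_eq)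
    then show ?thesis by (simp add: homogeneous_0_dir_deriv homogeneous_foldr)
  qed
qed simp

section \<open>Nonnegative coefficients and positivity\<close>

lemma nonneg_coeffs_pdiff: "nonneg_coeffs f \<Longrightarrow> nonneg_coeffs (pdiff i f)"
  by (simp add: nonneg_coeffs_def lookup_pdiff)

lemma nonneg_coeffs_dir_deriv:
  "nonneg_coeffs f \<Longrightarrow> v \<in> nonneg_orthant \<Longrightarrow> nonneg_coeffs (dir_deriv v f)"
  by (auto simp: nonneg_coeffs_def lookup_dir_deriv nonneg_orthant_def intro!: sum_nonneg)

lemma nonneg_coeffs_foldr:
  "nonneg_coeffs f \<Longrightarrow> set vs \<subseteq> nonneg_orthant \<Longrightarrow> nonneg_coeffs (foldr dir_deriv vs f)"
  by (induction vs) (auto intro: nonneg_coeffs_dir_deriv)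

text \<open>Derivatives along strictly positive vectors keep a nonzero homogeneous polynomial with
  nonnegative coefficients nonzero until its degree is used up. This gives the strict positivity
  behind reverse Cauchy-Schwarz and the logarithms.\<close>

definition pos_orthant :: "(real ^ 'n) set" where
  "pos_orthant = {u. \<forall>i. 0 < u $ i}"

lemma pos_orthant_subset: "pos_orthant \<subseteq> nonneg_orthant"
  by (auto simp: pos_orthant_def nonneg_orthant_def less_imp_le)

text \<open>Nonnegative terms cannot cancel. A single positive coordinate suffices, so vectors with
  zero entries, such as \<open>v\<close> restricted to a set of variables, are covered.\<close>

lemma dir_deriv_nonzero:
  assumes "nonneg_coeffs f" "v \<in> nonneg_orthant" "0 < v $ i" "pdiff i f \<noteq> 0"
  shows "dir_deriv v f \<noteq> 0"
proof -
  obtain m where m: "Poly_Mapping.lookup (pdiff i f) m \<noteq> 0"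
    using nonzero_lookupE[OF assms(4)] .
  have nn: "0 \<le> Poly_Mapping.lookup (pdiff j f) m" for j
    using nonneg_coeffs_pdiff[OF assms(1)] by (simp add: nonneg_coeffs_def)
  have "0 < (\<Sum>j\<in>UNIV. v $ j * Poly_Mapping.lookup (pdiff j f) m)"
  proof (rule sum_pos2[of _ i])
    have "0 < Poly_Mapping.lookup (pdiff i f) m" using nn[of i] m by linarith
    then show "0 < v $ i * Poly_Mapping.lookup (pdiff i f) m" using assms(3) by simp
    show "0 \<le> v $ j * Poly_Mapping.lookup (pdiff j f) m" for j
      using assms(2) nn[of j] by (simp add: nonneg_orthant_def)
  qed simp_all
  also have "\<dots> = Poly_Mapping.lookup (dir_deriv v f) m"
    by (simp add: dir_deriv_def lookup_sum)
  finally show ?thesis by auto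
qed

lemma homogeneous_0_lookup_pos:
  assumes "homogeneous 0 f" "nonneg_coeffs f" "f \<noteq> 0"
  shows "0 < Poly_Mapping.lookup f 0"
proof -
  obtain m where m: "Poly_Mapping.lookup f m \<noteq> 0"
    using nonzero_lookupE[OF assms(3)] .
  then have "m = 0"
    using assms(1) by (intro poly_mapping_eqI) (auto simp: homogeneous_lookup)
  moreover have "0 \<le> Poly_Mapping.lookup f m" using assms(2) by (simp add: nonneg_coeffs_def)
  ultimately show ?thesis using m by simp
qed

lemma homogeneous_Suc_pdiff_nonzero:
  assumes "homogeneous (Suc d) f" "f \<noteq> 0"
  obtains i where "pdiff i f \<noteq> 0"
proof -
  obtain m where m: "Poly_Mapping.lookup f m \<noteq> 0"
    using nonzero_lookupE[OF assms(2)] .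
  then have "(\<Sum>i\<in>UNIV. Poly_Mapping.lookup m i) = Suc d"
    using assms(1) by (auto simp: homogeneous_lookup)
  then have "(\<Sum>i\<in>UNIV. Poly_Mapping.lookup m i) \<noteq> 0" by simp
  then obtain i where "Poly_Mapping.lookup m i \<noteq> 0"
    by (rule sum.not_neutral_contains_not_neutral)
  then have "i \<in> pvars f" using m by (auto simp: pvars_def in_keys_iff)
  then show ?thesis using that[of i] by (simp add: pdiff_nonzero_iff)
qed

lemma foldr_dir_deriv_nonzero:
  assumes "homogeneous (length vs + d) f" "nonneg_coeffs f" "set vs \<subseteq> pos_orthant" "f \<noteq> 0"
  shows "foldr dir_deriv vs f \<noteq> 0"
  using assms
proof (induction vs arbitrary: d)
  case (Cons v vs)
  let ?g = "foldr dir_deriv vs f"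
  have hom: "homogeneous (Suc d) ?g"
    using Cons.prems(1) by (intro homogeneous_foldr) simp
  have "?g \<noteq> 0" by (rule Cons.IH[of "Suc d"]) (use Cons.prems in auto)
  then obtain i where i: "pdiff i ?g \<noteq> 0" by (rule homogeneous_Suc_pdiff_nonzero[OF hom])
  have nn: "nonneg_coeffs ?g"
    using Cons.prems pos_orthant_subset by (intro nonneg_coeffs_foldr) auto
  have "v \<in> nonneg_orthant" "0 < v $ i"
    using Cons.prems(3) pos_orthant_subset by (auto simp: pos_orthant_def)
  then show ?case
    using dir_deriv_nonzero[OF nn _ _ i, of v] by simp
qed simp

lemma foldr_dir_deriv_pos:
  assumes "homogeneous (length vs) f" "nonneg_coeffs f" "set vs \<subseteq> pos_orthant" "f \<noteq> 0"
  shows "0 < Poly_Mapping.lookup (foldr dir_deriv vs f) 0"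
proof (rule homogeneous_0_lookup_pos)
  show "homogeneous 0 (foldr dir_deriv vs f)"
    by (rule homogeneous_foldr) (simp add: assms(1))
  show "nonneg_coeffs (foldr dir_deriv vs f)"
    by (rule nonneg_coeffs_foldr[OF assms(2) order_trans[OF assms(3) pos_orthant_subset]])
  show "foldr dir_deriv vs f \<noteq> 0"
    by (rule foldr_dir_deriv_nonzero[of _ 0]) (simp_all add: assms)
qed


section \<open>Evaluation\<close>

lemma peval_superset:
  assumes "finite A" "Poly_Mapping.keys f \<subseteq> A"
  shows "peval f u = (\<Sum>m\<in>A.
      Poly_Mapping.lookup f m * (\<Prod>i\<in>UNIV. (u $ i) ^ Poly_Mapping.lookup m i))"
  unfolding peval_def using assms
  by (intro sum.mono_neutral_left) (auto simp: in_keys_iff)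

lemma peval_add: "peval (f + g) u = peval f u + peval g u"
proof -
  let ?A = "Poly_Mapping.keys f \<union> Poly_Mapping.keys g"
  have "finite ?A" by simp
  note sup = peval_superset[OF this]
  have "peval (f + g) u = (\<Sum>m\<in>?A. Poly_Mapping.lookup (f + g) m *
      (\<Prod>i\<in>UNIV. (u $ i) ^ Poly_Mapping.lookup m i))"
    by (rule sup) (rule keys_add)
  also have "\<dots> = peval f u + peval g u"
    by (simp only: sup[of f, OF Un_upper1] sup[of g, OF Un_upper2] lookup_add distrib_right sum.distrib)
  finally show ?thesis .
qed

lemma peval_zero [simp]: "peval 0 u = 0"
  by (simp add: peval_def)

lemma peval_sum: "peval (sum g A) u = (\<Sum>x\<in>A. peval (g x) u)"
  by (induction A rule: infinite_finite_induct) (simp_all add: peval_add)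

lemma peval_single:
  "peval (Poly_Mapping.single m c) u = c * (\<Prod>i\<in>UNIV. (u $ i) ^ Poly_Mapping.lookup m i)"
proof -
  have "finite {m}" "Poly_Mapping.keys (Poly_Mapping.single m c) \<subseteq> {m}" by simp_all
  from peval_superset[OF this] show ?thesis by simp
qed

lemma peval_const_times: "peval (Poly_Mapping.single 0 c * f) u = c * peval f u"
proof -
  have "Poly_Mapping.keys (Poly_Mapping.single 0 c * f) \<subseteq> Poly_Mapping.keys f"
    by (auto simp: in_keys_iff)
  from peval_superset[OF finite_keys this] show ?thesis
    by (simp add: peval_def sum_distrib_left mult.assoc)
qed

lemma peval_dir_deriv_add:
  "peval (dir_deriv (a *\<^sub>R u + b *\<^sub>R v) f) w = a * peval (dir_deriv u f) w + b * peval (dir_deriv v f) w"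
  by (simp add: dir_deriv_add_left dir_deriv_scaleR peval_add peval_const_times)

lemma peval_nonneg:
  assumes "nonneg_coeffs f" "u \<in> nonneg_orthant"
  shows "0 \<le> peval f u"
  using assms unfolding peval_def nonneg_coeffs_def nonneg_orthant_def
  by (auto intro!: sum_nonneg mult_nonneg_nonneg prod_nonneg)

text \<open>The factor \<open>u $ i\<close> restores the exponent lowered by \<open>pdiff i\<close>,
  so each monomial is an eigenvector of the combined operator, its exponent at \<open>i\<close>
  being the eigenvalue. Multiplying instead of dividing includes \<open>u $ i = 0\<close>.\<close>

lemma peval_pdiff:
  "u $ i * peval (pdiff i f) u = (\<Sum>m\<in>Poly_Mapping.keys f. real (Poly_Mapping.lookup m i) *
     (Poly_Mapping.lookup f m * (\<Prod>j\<in>UNIV. (u $ j) ^ Poly_Mapping.lookup m j)))"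
proof -
  let ?mon = "\<lambda>m. \<Prod>j\<in>UNIV. (u $ j) ^ Poly_Mapping.lookup m j"
  have mon: "u $ i * ?mon (m - Poly_Mapping.single i 1) = ?mon m"
    if nz: "Poly_Mapping.lookup m i \<noteq> 0" for m
  proof -
    obtain k where k: "Poly_Mapping.lookup m i = Suc k"
      using nz by (cases "Poly_Mapping.lookup m i") simp_all
    have "(\<Prod>j\<in>UNIV - {i}. (u $ j) ^ Poly_Mapping.lookup (m - Poly_Mapping.single i 1) j) =
        (\<Prod>j\<in>UNIV - {i}. (u $ j) ^ Poly_Mapping.lookup m j)"
      by (rule prod.cong) (simp_all add: lookup_minus lookup_single)
    then have "?mon (m - Poly_Mapping.single i 1) =
        (u $ i) ^ k * (\<Prod>j\<in>UNIV - {i}. (u $ j) ^ Poly_Mapping.lookup m j)"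
      by (simp only: prod.remove[OF finite UNIV_I, of _ i] lookup_minus lookup_single k) simp
    moreover have "?mon m = (u $ i) ^ Suc k * (\<Prod>j\<in>UNIV - {i}. (u $ j) ^ Poly_Mapping.lookup m j)"
      by (simp only: prod.remove[OF finite UNIV_I, of _ i] k)
    ultimately show ?thesis by (simp only: power_Suc mult.assoc)
  qed
  have "u $ i * (Poly_Mapping.lookup f m * real (Poly_Mapping.lookup m i) *
        ?mon (m - Poly_Mapping.single i 1)) =
      real (Poly_Mapping.lookup m i) * (Poly_Mapping.lookup f m * ?mon m)" for m
  proof (cases "Poly_Mapping.lookup m i = 0")
    case False
    show ?thesis unfolding mon[OF False, symmetric] by (simp only: mult_ac)
  qed simp
  then show ?thesis
    unfolding pdiff_def peval_sum peval_single sum_distrib_left by (intro sum.cong refl)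
qed

text \<open>Summed over \<open>i\<close>, the eigenvalues in \<open>peval_pdiff\<close> add up to
  the total degree of the monomial.\<close>

lemma euler_identity:
  assumes "homogeneous d f"
  shows "peval (dir_deriv u f) u = d * peval f u"
proof -
  have "peval (dir_deriv u f) u = (\<Sum>i\<in>UNIV. u $ i * peval (pdiff i f) u)"
    by (simp add: dir_deriv_def peval_sum peval_const_times)
  also have "\<dots> = (\<Sum>m\<in>Poly_Mapping.keys f. (\<Sum>i\<in>UNIV. real (Poly_Mapping.lookup m i)) *
     (Poly_Mapping.lookup f m * (\<Prod>j\<in>UNIV. (u $ j) ^ Poly_Mapping.lookup m j)))"
    by (simp only: peval_pdiff sum_distrib_right) (rule sum.swap)
  also have "\<dots> = (\<Sum>m\<in>Poly_Mapping.keys f. real d *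
     (Poly_Mapping.lookup f m * (\<Prod>j\<in>UNIV. (u $ j) ^ Poly_Mapping.lookup m j)))"
    using assms by (intro sum.cong) (auto simp: homogeneous_def simp flip: of_nat_sum)
  also have "\<dots> = d * peval f u"
    by (simp add: peval_def sum_distrib_left)
  finally show ?thesis .
qed

lemma peval_homogeneous_0:
  assumes "homogeneous 0 f"
  shows "peval f u = Poly_Mapping.lookup f 0"
proof -
  have "Poly_Mapping.keys f \<subseteq> {0}"
  proof
    fix m assume "m \<in> Poly_Mapping.keys f"
    then have "m = 0"
      using assms by (intro poly_mapping_eqI) (auto simp: homogeneous_def)
    then show "m \<in> {0}" by simp
  qed
  from peval_superset[OF _ this] show ?thesis by simp
qed

text \<open>Euler's identity applied \<open>d\<close> times. It turns point values into full
  iterated derivatives, the constants to which the bilinear forms apply.\<close>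

lemma fact_peval:
  assumes "homogeneous d f"
  shows "fact d * peval f u = Poly_Mapping.lookup (foldr dir_deriv (replicate d u) f) 0"
  using assms
proof (induction d arbitrary: f)
  case 0
  then show ?case by (simp add: peval_homogeneous_0)
next
  case (Suc d)
  have "fact (Suc d) * peval f u = fact d * (real (Suc d) * peval f u)"
    by (simp add: algebra_simps)
  also have "\<dots> = fact d * peval (dir_deriv u f) u"
    using euler_identity[OF Suc.prems] by simp
  also have "\<dots> = Poly_Mapping.lookup (foldr dir_deriv (replicate d u) (dir_deriv u f)) 0"
    by (rule Suc.IH) (rule homogeneous_dir_deriv[OF Suc.prems])
  finally show ?case
    by (simp only: replicate_Suc foldr_Cons o_apply foldr_dir_deriv_commute)
qed

section \<open>Iterated partial derivatives\<close>

lemma pdiffs_0: "pdiffs (\<lambda>_. 0) f = f"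
proof -
  interpret comp_fun_commute "\<lambda>i::'a. pdiff i ^^ (0 :: nat)"
    by (rule comp_fun_commute_pdiffs)
  have "Finite_Set.fold (\<lambda>i. pdiff i ^^ (0 :: nat)) f A = f" if "finite A" for A
    using that
  proof induction
    case (insert i A)
    show ?case unfolding fold_insert[OF insert.hyps] insert.IH by (rule funpow_0)
  qed simp
  then show ?thesis by (simp add: pdiffs_def)
qed

text \<open>Lets hypotheses on \<open>pdiffs \<alpha> f\<close> descend to \<open>pdiff i f\<close>.
  Away from \<open>i\<close> the two exponent families agree, so the extra \<open>pdiff i\<close>
  can be pulled out of the fold and absorbed into the power at \<open>i\<close>.\<close>

lemma pdiffs_pdiff: "pdiffs \<alpha> (pdiff i f) = pdiffs (\<alpha>(i := Suc (\<alpha> i))) f"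
proof -
  let ?\<beta> = "\<alpha>(i := Suc (\<alpha> i))"
  interpret a: comp_fun_commute "\<lambda>i. pdiff i ^^ \<alpha> i" by (rule comp_fun_commute_pdiffs)
  interpret b: comp_fun_commute "\<lambda>i. pdiff i ^^ ?\<beta> i" by (rule comp_fun_commute_pdiffs)
  have *: "Finite_Set.fold (\<lambda>j. pdiff j ^^ \<alpha> j) (pdiff i f) A =
      pdiff i (Finite_Set.fold (\<lambda>j. pdiff j ^^ ?\<beta> j) f A)" if "finite A" "i \<notin> A" for A
    using that
  proof induction
    case (insert j A)
    then have "?\<beta> j = \<alpha> j" and IH: "Finite_Set.fold (\<lambda>j. pdiff j ^^ \<alpha> j) (pdiff i f) A =
      pdiff i (Finite_Set.fold (\<lambda>j. pdiff j ^^ ?\<beta> j) f A)" by auto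
    then show ?case
      unfolding a.fold_insert[OF insert.hyps] b.fold_insert[OF insert.hyps]
      by (simp only: IH pdiff_funpow_commute)
  qed simp
  have "pdiffs \<alpha> (pdiff i f) = (pdiff i ^^ \<alpha> i)
      (Finite_Set.fold (\<lambda>j. pdiff j ^^ \<alpha> j) (pdiff i f) (UNIV - {i}))"
    unfolding pdiffs_def by (rule a.fold_rec) auto
  also have "\<dots> = (pdiff i ^^ ?\<beta> i) (Finite_Set.fold (\<lambda>j. pdiff j ^^ ?\<beta> j) f (UNIV - {i}))"
    unfolding *[of "UNIV - {i}", simplified] pdiff_funpow_commute by simp
  also have "\<dots> = pdiffs ?\<beta> f"
    unfolding pdiffs_def by (rule b.fold_rec[symmetric]) auto
  finally show ?thesis .
qed


section \<open>The quadratic forms of the iterated derivatives\<close>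

text \<open>The Hessian of \<open>g\<close> at the origin as a bilinear form. For \<open>g\<close>
  homogeneous of degree 2 the second derivatives are constants, so the coefficient at 0 loses
  nothing.\<close>

definition polar_form :: "'n::finite rpoly \<Rightarrow> real ^ 'n \<Rightarrow> real ^ 'n \<Rightarrow> real" where
  "polar_form g x y = Poly_Mapping.lookup (dir_deriv x (dir_deriv y g)) 0"

lemma bilinear_polar_form: "bilinear (polar_form g)"
  by (simp add: bilinear_def linear_iff polar_form_def dir_deriv_add_left dir_deriv_add
      dir_deriv_scaleR dir_deriv_const_times lookup_add)

lemma polar_form_sym: "polar_form g x y = polar_form g y x"
  unfolding polar_form_def by (subst dir_deriv_commute) (rule refl)

lemma polar_form_add: "polar_form (g + h) x y = polar_form g x y + polar_form h x y"
  by (simp add: polar_form_def dir_deriv_add lookup_add)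

lemma polar_form_const_times:
  "polar_form (Poly_Mapping.single 0 c * g) x y = c * polar_form g x y"
  by (simp add: polar_form_def dir_deriv_const_times)

lemma polar_form_nonneg:
  assumes "nonneg_coeffs g" "x \<in> nonneg_orthant" "y \<in> nonneg_orthant"
  shows "0 \<le> polar_form g x y"
  using nonneg_coeffs_dir_deriv[OF nonneg_coeffs_dir_deriv[OF assms(1,3)] assms(2)]
  by (simp add: polar_form_def nonneg_coeffs_def)

lemma nsd_on_hyperplane_polar_form_0: "nsd_on_hyperplane (polar_form 0)"
  unfolding nsd_on_hyperplane_def
  by (rule exI[of _ "\<lambda>_. 0"]) (simp add: polar_form_def linear_iff)

lemma polar_form_diag:
  assumes "homogeneous 2 f"
  shows "polar_form f x x = 2 * peval f x"
  using fact_peval[OF assms, of x] by (simp add: polar_form_def numeral_2_eq_2)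

lemma log_concaveD:
  assumes "log_concave f" "u \<in> nonneg_orthant" "v \<in> nonneg_orthant" "0 \<le> t" "t \<le> 1"
  shows "peval f u powr t * peval f v powr (1 - t) \<le> peval f (t *\<^sub>R u + (1 - t) *\<^sub>R v)"
  using assms by (simp add: log_concave_def)

text \<open>The functional is \<open>polar_form f e\<close> with \<open>e\<close> the all-ones
  vector. On its kernel the points \<open>?u\<close> and \<open>?v\<close> have equal values and
  midpoint \<open>e\<close>, so log-concavity at \<open>t = 1/2\<close> bounds this value by the one
  at \<open>e\<close>; the quadratic term is therefore at most 0.\<close>

lemma nsd_quadratic:
  fixes f :: "'n::finite rpoly"
  assumes hom: "homogeneous 2 f" and lc: "log_concave f"
  shows "nsd_on_hyperplane (polar_form f)"
  unfolding nsd_on_hyperplane_def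
proof (intro exI conjI allI impI)
  note bil = bilinear_polar_form[of f]
  define e :: "real ^ 'n" where "e = (\<chi> i. 1)"
  show "linear (polar_form f e)" using bil by (simp add: bilinear_def)
  fix x assume x: "polar_form f e x = 0"
  then have x': "polar_form f x e = 0" by (simp add: polar_form_sym)
  \<comment> \<open>Small enough for both points to stay in the orthant; the summand 1 covers
    \<open>x = 0\<close>.\<close>
  define s where "s = 1 / (1 + norm x)"
  have norm: "0 < 1 + norm x" by (simp add: add_pos_nonneg)
  then have s: "0 < s" by (simp add: s_def)
  have le1: "\<bar>s * x $ i\<bar> \<le> 1" for i
  proof -
    have "\<bar>x $ i\<bar> \<le> 1 + norm x" using component_le_norm_cart[of x i] by linarith
    moreover have "\<bar>s * x $ i\<bar> = \<bar>x $ i\<bar> / (1 + norm x)" using norm by (simp add: s_def abs_mult)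
    ultimately show ?thesis using norm by simp
  qed
  let ?u = "e + s *\<^sub>R x" and ?v = "e - s *\<^sub>R x"
  have "0 \<le> 1 + s * x $ i" "0 \<le> 1 - s * x $ i" for i
    using le1[of i] by linarith+
  then have uv: "?u \<in> nonneg_orthant" "?v \<in> nonneg_orthant"
    by (simp_all add: nonneg_orthant_def e_def)
  have q: "polar_form f ?u ?u = polar_form f e e + s\<^sup>2 * polar_form f x x"
    "polar_form f ?v ?v = polar_form f e e + s\<^sup>2 * polar_form f x x"
    by (simp_all add: bilinear_ladd[OF bil] bilinear_radd[OF bil] bilinear_lsub[OF bil]
        bilinear_rsub[OF bil] bilinear_lmul[OF bil] bilinear_rmul[OF bil] x x' power2_eq_square)
  then have eq: "peval f ?v = peval f ?u" by (simp add: polar_form_diag[OF hom])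
  have "peval f ?u powr (1/2) * peval f ?v powr (1 - 1/2) \<le> peval f ((1/2) *\<^sub>R ?u + (1 - 1/2) *\<^sub>R ?v)"
    by (rule log_concaveD[OF lc uv]) simp_all
  also have "(1/2) *\<^sub>R ?u + (1 - 1/2) *\<^sub>R ?v = e"
    by (simp add: vec_eq_iff field_simps)
  also have "peval f ?u powr (1/2) * peval f ?v powr (1 - 1/2) = peval f ?u"
    using lc uv(1) unfolding eq powr_add[symmetric] by (simp add: log_concave_def)
  finally have "polar_form f ?u ?u \<le> polar_form f e e"
    by (simp add: polar_form_diag[OF hom])
  then have "s\<^sup>2 * polar_form f x x \<le> 0"
    using q(1) by linarith
  then show "polar_form f x x \<le> 0" using s by (simp add: mult_le_0_iff)
qed

text \<open>Induction on \<open>vs\<close> for all \<open>f\<close> at once: one partial derivative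
  uses up one unit of \<open>\<alpha>\<close>, so every \<open>pdiff j f\<close> inherits both
  hypotheses with one vector fewer.\<close>

lemma nsd_polar_form:
  fixes f :: "'n::finite rpoly"
  assumes "homogeneous (length vs + 2) f" "nonneg_coeffs f"
    and "\<And>\<alpha> :: 'n \<Rightarrow> nat. (\<Sum>i\<in>UNIV. \<alpha> i) \<le> length vs \<Longrightarrow> indecomposable (pdiffs \<alpha> f)"
    and "\<And>\<alpha> :: 'n \<Rightarrow> nat. (\<Sum>i\<in>UNIV. \<alpha> i) = length vs \<Longrightarrow> log_concave (pdiffs \<alpha> f)"
    and "set vs \<subseteq> pos_orthant"
  shows "nsd_on_hyperplane (polar_form (foldr dir_deriv vs f))"
  using assms
proof (induction vs arbitrary: f)
  case Nil
  then have "log_concave f" using Nil.prems(4)[of "\<lambda>_. 0"] by (simp add: pdiffs_0)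
  moreover have "homogeneous 2 f" using Nil.prems(1) by (simp add: numeral_2_eq_2)
  ultimately show ?case by (simp add: nsd_quadratic)
next
  case (Cons v vs)
  note hom = Cons.prems(1) and nn = Cons.prems(2)
  have vpos: "0 < v $ i" for i using Cons.prems(5) by (simp add: pos_orthant_def)
  have vs: "set vs \<subseteq> pos_orthant" "set vs \<subseteq> nonneg_orthant"
    using Cons.prems(5) pos_orthant_subset by auto
  have hom': "homogeneous (Suc (length vs + 2)) f" using hom by simp
  have sum_upd: "(\<Sum>j\<in>UNIV. (\<alpha>(i := Suc (\<alpha> i))) j) = Suc (\<Sum>j\<in>UNIV. \<alpha> j)" for \<alpha> :: "'n \<Rightarrow> nat" and i
    by (simp add: sum.remove[of UNIV i])
  define B where "B j = polar_form (foldr dir_deriv vs (pdiff j f))" for j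
  have nsd_B: "nsd_on_hyperplane (B j)" for j
    unfolding B_def
  proof (rule Cons.IH)
    show "homogeneous (length vs + 2) (pdiff j f)" by (rule homogeneous_pdiff[OF hom'])
    show "nonneg_coeffs (pdiff j f)" by (rule nonneg_coeffs_pdiff[OF nn])
    show "indecomposable (pdiffs \<alpha> (pdiff j f))" if "(\<Sum>i\<in>UNIV. \<alpha> i) \<le> length vs" for \<alpha>
      unfolding pdiffs_pdiff by (rule Cons.prems(3)) (use that sum_upd in simp)
    show "log_concave (pdiffs \<alpha> (pdiff j f))" if "(\<Sum>i\<in>UNIV. \<alpha> i) = length vs" for \<alpha>
      unfolding pdiffs_pdiff by (rule Cons.prems(4)) (use that sum_upd in simp)
    show "set vs \<subseteq> pos_orthant" by (rule vs(1))
  qed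
  \<comment> \<open>Restricting \<open>v\<close> to \<open>T\<close> makes \<open>S T\<close> the
    partial sum of the forms \<open>v $ i * B i\<close> over \<open>T\<close> and at the same time
    the polar form of a single polynomial.\<close>
  define w where "w T = (\<chi> i. if i \<in> T then v $ i else 0)" for T
  have w_nonneg: "w T \<in> nonneg_orthant" for T
    using vpos by (simp add: w_def nonneg_orthant_def less_imp_le)
  define S where "S T = polar_form (foldr dir_deriv vs (dir_deriv (w T) f))" for T
  have S_insert: "S (insert j T) = (\<lambda>x y. S T x y + v $ j * B j x y)" if "j \<notin> T" for j T
  proof -
    have "w (insert j T) = w T + v $ j *\<^sub>R axis j 1"
      using that by (auto simp: vec_eq_iff w_def axis_def)
    then show ?thesis
      by (intro ext) (simp add: S_def B_def dir_deriv_add_left dir_deriv_scaleR dir_deriv_axis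
          foldr_dir_deriv_add foldr_dir_deriv_const_times polar_form_add polar_form_const_times)
  qed
  \<comment> \<open>Both sides are the derivative of \<open>f\<close> in the directions \<open>axis j 1\<close>, \<open>w T\<close>, \<open>y\<close> and \<open>vs\<close>.\<close>
  have S_axis: "S T (axis j 1) y = B j (w T) y" for T j y
  proof -
    have "dir_deriv a (dir_deriv b (dir_deriv c g)) = dir_deriv c (dir_deriv b (dir_deriv a g))"
      for a b c and g :: "'n rpoly"
      by (simp only: dir_deriv_commute[of a] dir_deriv_commute[of b c])
    then show ?thesis
      unfolding S_def B_def polar_form_def foldr_dir_deriv_commute dir_deriv_axis[symmetric] by simp
  qed
  have grow: "\<exists>j\<in>pvars f - T. nsd_on_hyperplane (S (insert j T))"
    if T: "T \<noteq> {}" "T \<subset> pvars f" and nsd: "nsd_on_hyperplane (S T)" for T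
  proof -
    have "indecomposable f" using Cons.prems(3)[of "\<lambda>_. 0"] by (simp add: pdiffs_0)
    moreover obtain i0 j0 where ij0: "i0 \<in> T" "j0 \<in> pvars f - T" using T by blast
    ultimately have "(i0, j0) \<in> (var_graph f)\<^sup>*"
      using T by (auto simp: indecomposable_iff_connected pdiff_nonzero_iff)
    moreover have "j0 \<notin> T" using ij0 by simp
    \<comment> \<open>A path that ends outside \<open>T\<close> has an edge that leaves
      \<open>T\<close>.\<close>
    ultimately have "\<exists>i j. (i, j) \<in> var_graph f \<and> i \<in> T \<and> j \<notin> T"
      using ij0(1) by (induction rule: rtrancl_induct) blast+
    then obtain i j where ij: "(i, j) \<in> var_graph f" "i \<in> T" "j \<notin> T" by blast
    then have nz: "pdiff i (pdiff j f) \<noteq> 0" by (simp add: var_graph_def)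
    then have j: "j \<in> pvars f" by (auto simp flip: pdiff_nonzero_iff)
    \<comment> \<open>The point at which the common functional is shown to be nonzero: the edge from
      \<open>i\<close> in \<open>T\<close> to \<open>j\<close> keeps
      \<open>dir_deriv (w T) (pdiff j f)\<close> nonzero, and the remaining directions are strictly
      positive.\<close>
    define e :: "real ^ 'n" where "e = (\<chi> i. 1)"
    have e: "e \<in> pos_orthant" by (simp add: e_def pos_orthant_def)
    have "0 < Poly_Mapping.lookup (foldr dir_deriv (e # vs) (dir_deriv (w T) (pdiff j f))) 0"
    proof (rule foldr_dir_deriv_pos)
      show "homogeneous (length (e # vs)) (dir_deriv (w T) (pdiff j f))"
        using homogeneous_pdiff[OF hom'] by (intro homogeneous_dir_deriv) simp
      show "nonneg_coeffs (dir_deriv (w T) (pdiff j f))"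
        by (intro nonneg_coeffs_dir_deriv nonneg_coeffs_pdiff nn w_nonneg)
      show "set (e # vs) \<subseteq> pos_orthant" using e vs by simp
      have "0 < w T $ i" using ij vpos by (simp add: w_def)
      then show "dir_deriv (w T) (pdiff j f) \<noteq> 0"
        by (rule dir_deriv_nonzero[OF nonneg_coeffs_pdiff[OF nn] w_nonneg _ nz])
    qed
    then have "S T (axis j 1) e \<noteq> 0"
      unfolding S_axis
      by (simp add: B_def polar_form_def foldr_dir_deriv_commute dir_deriv_commute)
    moreover have axis: "axis j 1 \<in> (nonneg_orthant :: (real ^ 'n) set)"
      by (simp add: nonneg_orthant_def axis_def)
    \<comment> \<open>The second summand is \<open>v $ j * B j\<close>, written as the polar form of
      a scaled polynomial so that bilinearity and symmetry are instances of the general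
      facts.\<close>
    have "nsd_on_hyperplane (\<lambda>x y. S T x y +
        polar_form (Poly_Mapping.single 0 (v $ j) * foldr dir_deriv vs (pdiff j f)) x y)"
    proof (rule nsd_on_hyperplane_add)
      let ?C = "polar_form (Poly_Mapping.single 0 (v $ j) * foldr dir_deriv vs (pdiff j f))"
      have C: "?C = (\<lambda>x y. v $ j * B j x y)"
        by (intro ext) (simp add: polar_form_const_times B_def)
      show "bilinear (S T)" "bilinear ?C"
        by (simp_all add: S_def bilinear_polar_form)
      show "S T x y = S T y x" "?C x y = ?C y x" for x y
        by (simp_all add: S_def polar_form_sym)
      show "nsd_on_hyperplane (S T)" by (rule nsd)
      show "nsd_on_hyperplane ?C"
        unfolding C by (rule nsd_on_hyperplane_scale[OF nsd_B]) (simp add: vpos less_imp_le)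
      show "0 \<le> S T (axis j 1) (axis j 1)"
        unfolding S_def
        by (intro polar_form_nonneg nonneg_coeffs_foldr nonneg_coeffs_dir_deriv nn w_nonneg vs axis)
      \<comment> \<open>The scaling cancels the factor \<open>v $ j\<close> of \<open>?C\<close>, so
        \<open>?C ?c\<close> is \<open>B j (w T)\<close>, which \<open>S_axis\<close> identifies
        with \<open>S T (axis j 1)\<close>.\<close>
      let ?c = "(1 / v $ j) *\<^sub>R w T"
      have "?c \<in> nonneg_orthant"
        using w_nonneg[of T] vpos[of j] by (simp add: nonneg_orthant_def)
      then have "0 \<le> B j ?c ?c"
        unfolding B_def by (intro polar_form_nonneg nonneg_coeffs_foldr nonneg_coeffs_pdiff nn vs)
      then show "0 \<le> ?C ?c ?c" using vpos[of j] by (simp add: C)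
      have "B j ?c x = (1 / v $ j) * B j (w T) x" for x
        by (simp add: B_def bilinear_lmul[OF bilinear_polar_form])
      then show "S T (axis j 1) x = ?C ?c x" for x
        using vpos[of j] by (simp add: S_axis C)
      show "S T (axis j 1) e \<noteq> 0" by fact
    qed
    then have "nsd_on_hyperplane (S (insert j T))"
      using S_insert[OF ij(3)] by (simp add: polar_form_const_times B_def)
    then show ?thesis using ij j by blast
  qed
  have reach: "nsd_on_hyperplane (S (pvars f))"
    if "T \<noteq> {}" "T \<subseteq> pvars f" "nsd_on_hyperplane (S T)" for T
    using that
  proof (induction "card (pvars f - T)" arbitrary: T rule: less_induct)
    case less
    show ?case
    proof (cases "T = pvars f")
      case False
      then obtain j where j: "j \<in> pvars f - T" "nsd_on_hyperplane (S (insert j T))"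
        using grow[of T] less.prems by auto
      have "card (pvars f - insert j T) < card (pvars f - T)"
        using j by (intro psubset_card_mono) auto
      then show ?thesis using less.hyps[of "insert j T"] less.prems j by simp
    qed (use less.prems in simp)
  qed
  have "w {} = 0" by (simp add: w_def vec_eq_iff)
  then have S_empty: "S {} = polar_form 0" by (simp add: S_def)
  have "nsd_on_hyperplane (S (pvars f))"
  proof (cases "pvars f = {}")
    case True
    then show ?thesis by (simp add: S_empty nsd_on_hyperplane_polar_form_0)
  next
    case False
    then obtain j where j: "j \<in> pvars f" by blast
    have "S {j} = (\<lambda>x y. v $ j * B j x y)"
      using S_insert[of j "{}"] by (simp add: S_empty polar_form_def)
    then have "nsd_on_hyperplane (S {j})"
      using nsd_on_hyperplane_scale[OF nsd_B] vpos[of j] by simp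
    then show ?thesis using reach[of "{j}"] j by simp
  qed
  \<comment> \<open>Partial derivatives in variables outside \<open>pvars f\<close> vanish, so
    \<open>v\<close> may be cut down to \<open>pvars f\<close>.\<close>
  moreover have "dir_deriv (w (pvars f)) f = dir_deriv v f"
    unfolding dir_deriv_def
  proof (rule sum.cong)
    fix i
    show "Poly_Mapping.single 0 (w (pvars f) $ i) * pdiff i f = Poly_Mapping.single 0 (v $ i) * pdiff i f"
      using pdiff_nonzero_iff[of i f] by (cases "i \<in> pvars f") (auto simp: w_def)
  qed simp
  ultimately show ?case by (simp add: S_def foldr_dir_deriv_commute)
qed


section \<open>Complete log-concavity\<close>

lemma funpow_dir_deriv_commute:
  "(dir_deriv u ^^ k) (dir_deriv v f) = dir_deriv v ((dir_deriv u ^^ k) f)"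
  using foldr_dir_deriv_commute[of "replicate k u"] by simp

lemma power_powr_commute: "0 < x \<Longrightarrow> (x ^ n) powr t = (x powr t) ^ n" for x :: real
  by (induction n) (simp_all add: powr_mult)

text \<open>Only mixed derivatives along \<open>u\<close> and \<open>v\<close> enter: positivity of
  the full ones allows roots and logarithms of the sequence \<open>a\<close>, and the hyperplane
  condition on the quadratic ones makes \<open>a\<close> log-concave.\<close>

lemma log_concave_inequality_of_nsd:
  fixes g :: "'n::finite rpoly"
  assumes hom: "homogeneous e g"
    and pos: "\<And>j. j \<le> e \<Longrightarrow>
      0 < Poly_Mapping.lookup ((dir_deriv u ^^ j) ((dir_deriv v ^^ (e - j)) g)) 0"
    and nsd: "\<And>j. j + 2 \<le> e \<Longrightarrow>
      nsd_on_hyperplane (polar_form ((dir_deriv u ^^ j) ((dir_deriv v ^^ (e - 2 - j)) g)))"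
    and t: "0 \<le> t" "t \<le> 1"
  shows "peval g u powr t * peval g v powr (1 - t) \<le> peval g (t *\<^sub>R u + (1 - t) *\<^sub>R v)"
proof (cases "e = 0")
  \<comment> \<open>Degree 0 admits no \<open>e\<close>-th root; the two powers of a positive
    constant multiply to the constant itself.\<close>
  case True
  then have "peval g x = Poly_Mapping.lookup g 0" for x
    using hom by (simp add: peval_homogeneous_0)
  moreover have "0 < Poly_Mapping.lookup g 0" using pos[of 0] True by simp
  ultimately show ?thesis by (simp flip: powr_add)
next
  case False
  define h where "h j m = (dir_deriv u ^^ j) ((dir_deriv v ^^ m) g)" for j m
  have Du: "dir_deriv u (h j m) = h (Suc j) m" for j m
    by (simp add: h_def)
  have Dv: "dir_deriv v (h j m) = h j (Suc m)" for j m
    by (simp add: h_def funpow_dir_deriv_commute)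
  have hom_h: "homogeneous r (h j m)" if "j + m + r = e" for j m r
  proof -
    have "h j m = foldr dir_deriv (replicate j u @ replicate m v) g"
      by (simp add: h_def)
    also have "homogeneous r \<dots>"
      by (rule homogeneous_foldr) (use that hom in simp)
    finally show ?thesis .
  qed
  define a where "a j = Poly_Mapping.lookup (h j (e - j)) 0" for j
  have a_pos: "0 < a j" if "j \<le> e" for j
    using pos[OF that] by (simp add: a_def h_def)
  \<comment> \<open>With \<open>k = j + 1\<close>, the form with \<open>j\<close> derivatives along
    \<open>u\<close> and \<open>e - 2 - j\<close> along \<open>v\<close> takes the values
    \<open>a (k + 1)\<close>, \<open>a k\<close> and \<open>a (k - 1)\<close> on the pairs formed
    from \<open>u\<close> and \<open>v\<close>.\<close>
  have a_lc: "a (k - 1) * a (k + 1) \<le> (a k)\<^sup>2" if k: "0 < k" "k < e" for k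
  proof -
    obtain j where j: "k = Suc j" using k(1) by (cases k) auto
    define m where "m = e - 2 - j"
    have m: "e - j = Suc (Suc m)" "e - Suc j = Suc m" "e - Suc (Suc j) = m"
      using k j by (auto simp: m_def)
    let ?B = "polar_form (h j m)"
    have B: "?B u u = a (k + 1)" "?B v v = a (k - 1)" "?B u v = a k"
      by (simp_all add: polar_form_def Du Dv a_def j m)
    have "?B u u * ?B v v \<le> (?B u v)\<^sup>2"
    proof (rule reverse_cauchy_schwarz[OF bilinear_polar_form polar_form_sym])
      show "nsd_on_hyperplane ?B"
        using nsd[of j] k j by (simp add: h_def m_def)
      show "0 < ?B v v" using a_pos[of j] k j by (simp add: B)
    qed
    then show ?thesis by (simp only: B mult.commute)
  qed
  obtain A B where AB: "0 < A" "0 < B" "a e = A ^ e" "a 0 = B ^ e"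
    and lower: "\<And>j. j \<le> e \<Longrightarrow> A ^ j * B ^ (e - j) \<le> a j"
  proof (rule log_concave_seq_lower_bound[of e a])
    show "0 < e" using False by simp
  qed (use a_pos a_lc in simp_all)
  let ?w = "t *\<^sub>R u + (1 - t) *\<^sub>R v" and ?M = "t * A + (1 - t) * B"
  \<comment> \<open>A binomial expansion, one factor at a time: Euler's identity yields a derivative
    along \<open>?w\<close>, which splits into those along \<open>u\<close> and \<open>v\<close>
    with weights \<open>t\<close> and \<open>1 - t\<close>. The start \<open>r = 0\<close> is
    \<open>lower\<close>; \<open>r = e\<close> is the bound for \<open>g\<close>.\<close>
  have bound: "?M ^ r * (A ^ j * B ^ m) \<le> fact r * peval (h j m) ?w" if "j + m + r = e" for r j m
    using that
  proof (induction r arbitrary: j m)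
    case 0
    then have "peval (h j m) ?w = a j" "m = e - j" "j \<le> e"
      using hom_h[of j m 0] by (auto simp: peval_homogeneous_0 a_def)
    then show ?case using lower[of j] by simp
  next
    case (Suc r)
    have "?M ^ Suc r * (A ^ j * B ^ m) =
        t * (?M ^ r * (A ^ Suc j * B ^ m)) + (1 - t) * (?M ^ r * (A ^ j * B ^ Suc m))"
      by (simp add: algebra_simps)
    also have "\<dots> \<le> t * (fact r * peval (h (Suc j) m) ?w) + (1 - t) * (fact r * peval (h j (Suc m)) ?w)"
      by (intro add_mono mult_left_mono Suc.IH) (use t Suc.prems in auto)
    also have "\<dots> = fact r * peval (dir_deriv ?w (h j m)) ?w"
      by (simp add: peval_dir_deriv_add Du Dv distrib_left mult_ac)
    also have "\<dots> = fact r * (Suc r * peval (h j m) ?w)"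
      using euler_identity[OF hom_h[OF Suc.prems]] by simp
    also have "\<dots> = fact (Suc r) * peval (h j m) ?w"
      by (simp add: algebra_simps)
    finally show ?case .
  qed
  have "A powr t * B powr (1 - t) \<le> ?M"
    using AB t by (intro Youngs_inequality_0) auto
  then have "(A powr t * B powr (1 - t)) ^ e \<le> ?M ^ e"
    by (intro power_mono) auto
  also have "\<dots> \<le> fact e * peval g ?w"
    using bound[of 0 0 e] by (simp add: h_def)
  also have "(A powr t * B powr (1 - t)) ^ e = (A ^ e) powr t * (B ^ e) powr (1 - t)"
    using AB by (simp add: power_mult_distrib power_powr_commute)
  also have "A ^ e = fact e * peval g u"
    using fact_peval[OF hom, of u] AB by (simp add: a_def h_def)
  also have "B ^ e = fact e * peval g v"
    using fact_peval[OF hom, of v] AB by (simp add: a_def h_def)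
  \<comment> \<open>The exponents add up to 1, so a single factor \<open>fact e\<close> remains and
    cancels.\<close>
  also have "(fact e * peval g u) powr t * (fact e * peval g v) powr (1 - t) =
      fact e * (peval g u powr t * peval g v powr (1 - t))"
  proof -
    have "0 < fact e * peval g u" "0 < fact e * peval g v"
      using AB fact_peval[OF hom, of u] fact_peval[OF hom, of v] by (simp_all add: a_def h_def)
    then have "0 \<le> peval g u" "0 \<le> peval g v"
      by (simp_all add: zero_less_mult_iff less_imp_le)
    then have "(fact e * peval g u) powr t * (fact e * peval g v) powr (1 - t) =
        (fact e powr t * fact e powr (1 - t)) * (peval g u powr t * peval g v powr (1 - t))"
      by (simp add: powr_mult)
    also have "fact e powr t * fact e powr (1 - t) = (fact e :: real)"
      by (simp flip: powr_add)
    finally show ?thesis .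
  qed
  finally show ?thesis by simp
qed

section \<open>Approximation from the interior of the orthant\<close>

text \<open>Coefficients of an iterated derivative are polynomials in the entries of the directions,
  hence continuous. The limit is one-sided because positive shifts lead into the open
  orthant.\<close>

lemma tendsto_lookup_foldr:
  "((\<lambda>\<epsilon>. Poly_Mapping.lookup (foldr dir_deriv (map (\<lambda>x. x + \<epsilon> *\<^sub>R c) xs) f) m) \<longlongrightarrow>
     Poly_Mapping.lookup (foldr dir_deriv xs f) m) (at_right 0)"
proof (induction xs arbitrary: m)
  case (Cons x xs)
  have "((\<lambda>\<epsilon>. x $ i + \<epsilon> * c $ i) \<longlongrightarrow> x $ i + 0 * c $ i) (at_right 0)" for i
    by (intro tendsto_intros)
  then show ?case
    unfolding list.map foldr_Cons o_apply lookup_dir_deriv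
    by (intro tendsto_sum tendsto_mult tendsto_const Cons.IH) simp
qed simp

text \<open>By \<open>fact_peval\<close> the evaluation point counts as \<open>e\<close> further
  directions, so moving the point and the directions together is one instance of the coefficient
  limit.\<close>

lemma tendsto_peval_foldr:
  assumes "homogeneous (length vs + e) f"
  shows "((\<lambda>\<epsilon>. peval (foldr dir_deriv (map (\<lambda>x. x + \<epsilon> *\<^sub>R c) vs) f) (u + \<epsilon> *\<^sub>R c)) \<longlongrightarrow>
     peval (foldr dir_deriv vs f) u) (at_right 0)"
proof -
  have "peval (foldr dir_deriv ws f) w =
      Poly_Mapping.lookup (foldr dir_deriv (replicate e w @ ws) f) 0 / fact e"
    if "length ws = length vs" for ws w
    using fact_peval[OF homogeneous_foldr[of ws e f], of w] assms that by (simp add: field_simps)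
  moreover have "((\<lambda>\<epsilon>. Poly_Mapping.lookup
      (foldr dir_deriv (map (\<lambda>x. x + \<epsilon> *\<^sub>R c) (replicate e u @ vs)) f) 0 / fact e) \<longlongrightarrow>
     Poly_Mapping.lookup (foldr dir_deriv (replicate e u @ vs) f) 0 / fact e) (at_right 0)"
    by (intro tendsto_divide tendsto_lookup_foldr tendsto_const) simp
  ultimately show ?thesis by (simp only: length_map map_append map_replicate)
qed

lemma log_concave_0: "log_concave 0"
  by (simp add: log_concave_def)

theorem theorem3p2:
  fixes f :: "'n::finite rpoly" and d :: nat
  assumes "2 \<le> d"
    and "homogeneous d f"
    and "nonneg_coeffs f"
    and "\<And>\<alpha> :: 'n \<Rightarrow> nat. (\<Sum>i\<in>UNIV. \<alpha> i) \<le> d - 2 \<Longrightarrow> indecomposable (pdiffs \<alpha> f)"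
    and "\<And>\<alpha> :: 'n \<Rightarrow> nat. (\<Sum>i\<in>UNIV. \<alpha> i) = d - 2 \<Longrightarrow> log_concave (pdiffs \<alpha> f)"
  shows "completely_log_concave f"
  unfolding completely_log_concave_def
proof (intro allI impI)
  fix vs :: "(real ^ 'n) list"
  assume vs: "set vs \<subseteq> nonneg_orthant"
  show "log_concave (foldr dir_deriv vs f)"
  proof (cases "f = 0 \<or> d < length vs")
    case True
    then have "foldr dir_deriv vs f = 0" using foldr_dir_deriv_eq_0[OF assms(2)] by auto
    then show ?thesis by (simp add: log_concave_0)
  next
    case False
    then have f: "f \<noteq> 0" by simp
    define e where "e = d - length vs"
    have d: "d = length vs + e" using False by (simp add: e_def)
    have pos_case: "peval (foldr dir_deriv ws f) u powr t * peval (foldr dir_deriv ws f) v powr (1 - t)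
        \<le> peval (foldr dir_deriv ws f) (t *\<^sub>R u + (1 - t) *\<^sub>R v)"
      if ws: "length ws = length vs" "set ws \<subseteq> pos_orthant" and uv: "u \<in> pos_orthant" "v \<in> pos_orthant"
        and t: "0 \<le> t" "t \<le> 1" for ws u v t
    proof (rule log_concave_inequality_of_nsd[where e = e])
      show "homogeneous e (foldr dir_deriv ws f)"
        using assms(2) d ws(1) by (intro homogeneous_foldr) simp
      have list: "(dir_deriv u ^^ j) ((dir_deriv v ^^ m) (foldr dir_deriv ws f)) =
          foldr dir_deriv (replicate j u @ replicate m v @ ws) f" for j m
        by simp
      have sub: "set (replicate j u @ replicate m v @ ws) \<subseteq> pos_orthant" for j m
        using ws uv by auto
      show "0 < Poly_Mapping.lookup
          ((dir_deriv u ^^ j) ((dir_deriv v ^^ (e - j)) (foldr dir_deriv ws f))) 0" if "j \<le> e" for j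
        unfolding list using assms(2) d ws(1) that
        by (intro foldr_dir_deriv_pos assms(3) sub f) (simp add: add.commute)
      show "nsd_on_hyperplane (polar_form
          ((dir_deriv u ^^ j) ((dir_deriv v ^^ (e - 2 - j)) (foldr dir_deriv ws f))))"
        if "j + 2 \<le> e" for j
      proof -
        \<comment> \<open>The directions \<open>u\<close>, \<open>v\<close> and those of
          \<open>ws\<close> add up to order \<open>d - 2\<close>, where the hypotheses on
          \<open>f\<close> concern quadratics.\<close>
        have len: "length (replicate j u @ replicate (e - 2 - j) v @ ws) = d - 2"
          using d ws(1) that by simp
        show ?thesis
          unfolding list
        proof (rule nsd_polar_form, unfold len)
          show "homogeneous (d - 2 + 2) f" using assms(1,2) by (simp only: le_add_diff_inverse2)
        qed (use assms(3,4,5) sub in blast)+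
      qed
    qed (fact t)+
    define c :: "real ^ 'n" where "c = (\<chi> i. 1)"
    have shift: "x + \<epsilon> *\<^sub>R c \<in> pos_orthant" if "x \<in> nonneg_orthant" "0 < \<epsilon>" for x \<epsilon>
      using that by (simp add: c_def pos_orthant_def nonneg_orthant_def add_nonneg_pos)
    let ?G = "\<lambda>\<epsilon> x. peval (foldr dir_deriv (map (\<lambda>x. x + \<epsilon> *\<^sub>R c) vs) f) (x + \<epsilon> *\<^sub>R c)"
    have lim: "((\<lambda>\<epsilon>. ?G \<epsilon> x) \<longlongrightarrow> peval (foldr dir_deriv vs f) x) (at_right 0)" for x
      by (rule tendsto_peval_foldr) (use assms(2) d in simp)
    have nonneg: "0 \<le> peval (foldr dir_deriv ws f) x"
      if "set ws \<subseteq> nonneg_orthant" "x \<in> nonneg_orthant" for ws x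
      using that by (intro peval_nonneg nonneg_coeffs_foldr assms(3))
    have lc: "peval (foldr dir_deriv vs f) u powr t * peval (foldr dir_deriv vs f) v powr (1 - t)
        \<le> peval (foldr dir_deriv vs f) (t *\<^sub>R u + (1 - t) *\<^sub>R v)"
      if uv: "u \<in> nonneg_orthant" "v \<in> nonneg_orthant" and t: "0 \<le> t" "t \<le> 1" for u v t
    proof -
      \<comment> \<open>The endpoints are separated because \<open>0 powr 0 = 0\<close> makes
        \<open>x powr 0\<close> discontinuous at \<open>x = 0\<close>, which would break the limit
        argument.\<close>
      consider "t = 0" | "t = 1" | "0 < t" "t < 1" using t by fastforce
      then show ?thesis
      proof cases
        case 3
        have ev: "\<forall>\<^sub>F \<epsilon> in at_right 0. 0 < (\<epsilon>::real)"
          by (rule eventually_at_right_less)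
        \<comment> \<open>The limits may be 0, and the limit rule for \<open>powr\<close> then asks
          for eventually nonnegative bases.\<close>
        have ev_nonneg: "\<forall>\<^sub>F \<epsilon> in at_right 0. 0 \<le> ?G \<epsilon> x" if "x \<in> nonneg_orthant" for x
          using ev
        proof (rule eventually_mono)
          fix \<epsilon> :: real assume "0 < \<epsilon>"
          then show "0 \<le> ?G \<epsilon> x"
            using shift vs that pos_orthant_subset by (intro nonneg) fastforce+
        qed
        show ?thesis
        proof (rule tendsto_le[OF trivial_limit_at_right_real])
          show "((\<lambda>\<epsilon>. ?G \<epsilon> (t *\<^sub>R u + (1 - t) *\<^sub>R v)) \<longlongrightarrow>
              peval (foldr dir_deriv vs f) (t *\<^sub>R u + (1 - t) *\<^sub>R v)) (at_right 0)"
            by (rule lim)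
          show "((\<lambda>\<epsilon>. ?G \<epsilon> u powr t * ?G \<epsilon> v powr (1 - t)) \<longlongrightarrow>
              peval (foldr dir_deriv vs f) u powr t * peval (foldr dir_deriv vs f) v powr (1 - t))
              (at_right 0)"
            by (intro tendsto_mult tendsto_powr' lim tendsto_const) (use 3 ev_nonneg uv in auto)
          show "\<forall>\<^sub>F \<epsilon> in at_right 0. ?G \<epsilon> u powr t * ?G \<epsilon> v powr (1 - t) \<le>
              ?G \<epsilon> (t *\<^sub>R u + (1 - t) *\<^sub>R v)"
            using ev
          proof (rule eventually_mono)
            fix \<epsilon> :: real assume \<epsilon>: "0 < \<epsilon>"
            \<comment> \<open>The weights sum to 1, so shifting by a fixed vector commutes with the
              convex combination and \<open>pos_case\<close> applies to the shifted points.\<close>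
            have eq: "t *\<^sub>R u + (1 - t) *\<^sub>R v + \<epsilon> *\<^sub>R c =
                t *\<^sub>R (u + \<epsilon> *\<^sub>R c) + (1 - t) *\<^sub>R (v + \<epsilon> *\<^sub>R c)"
              by (simp add: algebra_simps)
            have "set (map (\<lambda>x. x + \<epsilon> *\<^sub>R c) vs) \<subseteq> pos_orthant"
              using shift[OF _ \<epsilon>] vs by auto
            then show "?G \<epsilon> u powr t * ?G \<epsilon> v powr (1 - t) \<le> ?G \<epsilon> (t *\<^sub>R u + (1 - t) *\<^sub>R v)"
              unfolding eq by (intro pos_case shift uv \<epsilon> t) simp_all
          qed
        qed
      qed (use nonneg[OF vs] uv in \<open>simp_all add: powr_zero_eq_one\<close>)
    qed
    show ?thesis
      unfolding log_concave_def using lc nonneg[OF vs] by simp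
  qed
qed

end
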